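(* Let $G$ be a Lie group of dimension $\ge 2$ with Lie algebra $\mathfrak g$, let $g$ be a left-invariant pseudo-Riemannian metric on $G$, $H\in\bigwedge^3\mathfrak g^*$ a closed left-invariant three-form and $\delta\in E^*=(\mathfrak g\oplus\mathfrak g^* )^*$. For $u_\pm\in E_\pm$ consider the linear maps $$\Gamma_{u_+}=\mathrm{pr}_{E_+}\circ[u_+,\cdot]_H|_{E_-}:E_-\to E_+,\qquad \Gamma_{u_-}=\mathrm{pr}_{E_-}\circ[u_-,\cdot]_H|_{E_+}:E_+\to E_-,$$ where $\mathrm{pr}_{E_\pm}:E=E_+\oplus E_-\to E_\pm$ are the projections. Then the Ricci curvature of $(G,H,\mathcal G_g,\delta)$ is given, for all $u_+\in E_+$, $u_-\in E_-$, by $$Ric_\delta(u_-,u_+)=-\mathrm{tr}(\Gamma_{u_-}\circ\Gamma_{u_+})+\delta(\mathrm{pr}_{E_+}[u_-,u_+]_H),$$ $$Ric_\delta(u_+,u_-)=-\mathrm{tr}(\Gamma_{u_-}\circ\Gamma_{u_+})+\delta(\mathrm{pr}_{E_-}[u_+,u_-]_H).$$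
   Context: Let $E=\mathfrak g\oplus\mathfrak g^*$ (the space of left-invariant sections of $TG\oplus T^*G$), with scalar product $\langle X+\xi,Y+\eta\rangle=\frac12(\xi(Y)+\eta(X))$ and $H$-twisted Dorfman bracket $[X+\xi,Y+\eta]_H=[X,Y]-\mathrm{ad}_X^*\eta+\mathrm{ad}_Y^*\xi+H(X,Y,\cdot)$, where $\mathrm{ad}_X^*\eta=\eta\circ\mathrm{ad}_X$. The metric $g$ is identified with a non-degenerate symmetric bilinear form on $\mathfrak g$, and $gX=g(X,\cdot)$. The generalized metric of $g$ is $\mathcal G_g(X+\xi,Y+\eta)=\frac12(g(X,Y)+g^{-1}(\xi,\eta))$; the $\pm1$-eigenspaces of the associated involution are $E_\pm=\{X\pm gX: X\in\mathfrak g\}$. A left-invariant generalized connection is a linear map $D:E\to\mathfrak{so}(E)$, $u\mapsto D_u$ ($\mathfrak{so}(E)$ with respect to $\langle\cdot,\cdot\rangle$). Its torsion is $T(u,v)=D_uv-D_vu-[u,v]_H+(Du)^*v$, where $Du\in\mathrm{End}(E)$ is $w\mapsto D_wu$ and $*$ is the adjoint for $\langle\cdot,\cdot\rangle$. $D$ is a Levi-Civita generalized connection if $T=0$ and $D_uE_\pm\subset E_\pm$ for all $u\in E$. Its divergence is $\delta_D\in E^*$, $\delta_D(v)=\mathrm{tr}(u\mapsto D_uv)$. Given $\delta\in E^*$, choose a left-invariant Levi-Civita generalized connection $D$ with $\delta_D=\delta$ (one exists if $\dim G\ge2$), put $R(u,v)w=D_uD_vw-D_vD_uw-D_{[u,v]_H}w$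 and define $Ric^+_\delta(u_-,u_+)=\mathrm{tr}(E_+\ni w\mapsto R(w,u_-)u_+\in E_+)$ and $Ric^-_\delta(u_+,u_-)=\mathrm{tr}(E_-\ni w\mapsto R(w,u_+)u_-\in E_-)$ for $u_\pm\in E_\pm$. It is known that these do not depend on the choice of $D$. $Ric_\delta=Ric^+_\delta\oplus Ric^-_\delta$ is regarded as a bilinear form on $E$ vanishing on $E_+\times E_+$ and on $E_-\times E_-$. *)

theory Defs
  imports "HOL-Analysis.Analysis"
begin

text \<open>
  Left-invariant objects on a Lie group are given by tensors on its Lie algebra. The Lie algebra is
  modelled as a finite-dimensional real vector space \<open>'a :: euclidean_space\<close> with an explicit
  bracket \<open>br\<close>; the class serves only to express finite-dimensionality, and its inner product plays
  no role. The dual space is \<open>'a \<Rightarrow>\<^sub>L real\<close> (in finite dimension every linear form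
  is bounded), so that a pair \<open>(X, \<xi>)\<close> of type \<open>'a gtb\<close> stands for \<open>X + \<xi>\<close> in the sum of the
  Lie algebra and its dual.
\<close>

type_synonym 'a gtb = "'a \<times> ('a \<Rightarrow>\<^sub>L real)"

section \<open>Linear algebra\<close>

text \<open>
  Trace of a linear endomorphism \<open>f\<close> of a finite-dimensional subspace \<open>V\<close>. Only the values of \<open>f\<close>
  on \<open>V\<close> matter, so maps defined on a subspace may be given by any extension to the whole type.
\<close>

definition trace_on :: "'v::real_vector set \<Rightarrow> ('v \<Rightarrow> 'v) \<Rightarrow> real" where
  "trace_on V f = (let B = (SOME B. independent B \<and> span B = V) in
     (\<Sum>b\<in>B. representation B (f b) b))"

text \<open>Projection onto \<open>V\<close> along \<open>W\<close>, for complementary subspaces \<open>V\<close> and \<open>W\<close>.\<close>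

definition proj_along :: "'v::real_vector set \<Rightarrow> 'v set \<Rightarrow> 'v \<Rightarrow> 'v" where
  "proj_along V W u = (THE v. v \<in> V \<and> u - v \<in> W)"

section \<open>Lie algebra, metric, three-form\<close>

definition lie_bracket :: "('a::euclidean_space \<Rightarrow> 'a \<Rightarrow> 'a) \<Rightarrow> bool" where
  "lie_bracket br \<longleftrightarrow> bilinear br \<and> (\<forall>X. br X X = 0) \<and>
     (\<forall>X Y Z. br X (br Y Z) + br Y (br Z X) + br Z (br X Y) = 0)"

definition pseudo_metric :: "('a::euclidean_space \<Rightarrow> 'a \<Rightarrow> real) \<Rightarrow> bool" where
  "pseudo_metric g \<longleftrightarrow> bilinear g \<and> (\<forall>X Y. g X Y = g Y X) \<and>
     (\<forall>X. (\<forall>Y. g X Y = 0) \<longrightarrow> X = 0)"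

definition three_form :: "('a::euclidean_space \<Rightarrow> 'a \<Rightarrow> 'a \<Rightarrow> real) \<Rightarrow> bool" where
  "three_form H \<longleftrightarrow>
     (\<forall>Y Z. linear (\<lambda>X. H X Y Z)) \<and> (\<forall>X Z. linear (\<lambda>Y. H X Y Z)) \<and> (\<forall>X Y. linear (H X Y)) \<and>
     (\<forall>X Y Z. H X Y Z = - H Y X Z \<and> H X Y Z = - H X Z Y)"

text \<open>
  On left-invariant vector fields the exterior derivative of a left-invariant form reduces to
  \<open>dH(X\<^sub>0,\<dots>,X\<^sub>3) = \<Sum>\<^sub>i\<^sub><\<^sub>j (-1)\<^sup>i\<^sup>+\<^sup>j H([X\<^sub>i,X\<^sub>j],\<dots>)\<close>, with \<open>X\<^sub>i\<close> and \<open>X\<^sub>j\<close> omitted in the dots.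
\<close>

definition closed_form ::
  "('a::euclidean_space \<Rightarrow> 'a \<Rightarrow> 'a) \<Rightarrow> ('a \<Rightarrow> 'a \<Rightarrow> 'a \<Rightarrow> real) \<Rightarrow> bool" where
  "closed_form br H \<longleftrightarrow> (\<forall>W X Y Z.
     - H (br W X) Y Z + H (br W Y) X Z - H (br W Z) X Y
     - H (br X Y) W Z + H (br X Z) W Y - H (br Y Z) W X = 0)"

section \<open>The generalized tangent bundle\<close>

definition pairing :: "'a::euclidean_space gtb \<Rightarrow> 'a gtb \<Rightarrow> real" where
  "pairing u v = (blinfun_apply (snd u) (fst v) + blinfun_apply (snd v) (fst u)) / 2"

text \<open>The form part of the value sends \<open>Z\<close> to \<open>- \<eta> [X,Z] + \<xi> [Y,Z] + H(X,Y,Z)\<close>.\<close>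

definition dorfman ::
  "('a::euclidean_space \<Rightarrow> 'a \<Rightarrow> 'a) \<Rightarrow> ('a \<Rightarrow> 'a \<Rightarrow> 'a \<Rightarrow> real) \<Rightarrow> 'a gtb \<Rightarrow> 'a gtb \<Rightarrow> 'a gtb" where
  "dorfman br H u v =
     (br (fst u) (fst v),
      Blinfun (\<lambda>Z. - blinfun_apply (snd v) (br (fst u) Z) + blinfun_apply (snd u) (br (fst v) Z)
                 + H (fst u) (fst v) Z))"

definition flat :: "('a::euclidean_space \<Rightarrow> 'a \<Rightarrow> real) \<Rightarrow> 'a \<Rightarrow> ('a \<Rightarrow>\<^sub>L real)" where
  "flat g X = Blinfun (g X)"

definition gen_metric :: "('a::euclidean_space \<Rightarrow> 'a \<Rightarrow> real) \<Rightarrow> 'a gtb \<Rightarrow> 'a gtb \<Rightarrow> real" where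
  "gen_metric g u v =
     (g (fst u) (fst v) + g (inv (flat g) (snd u)) (inv (flat g) (snd v))) / 2"

definition E_plus :: "('a::euclidean_space \<Rightarrow> 'a \<Rightarrow> real) \<Rightarrow> 'a gtb set" where
  "E_plus g = {(X, flat g X) | X. True}"

definition E_minus :: "('a::euclidean_space \<Rightarrow> 'a \<Rightarrow> real) \<Rightarrow> 'a gtb set" where
  "E_minus g = {(X, - flat g X) | X. True}"

lemma blinfun_apply_flat: "pseudo_metric g \<Longrightarrow> blinfun_apply (flat g X) Y = g X Y"
  by (simp add: pseudo_metric_def flat_def bilinear_def bounded_linear_Blinfun_apply
      linear_conv_bounded_linear)

lemma bij_flat:
  assumes "pseudo_metric g"
  shows "bij (flat g)"
proof -
  have bil: "bilinear g" and sym: "\<And>X Y. g X Y = g Y X"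
    and nd: "\<And>X. (\<forall>Y. g X Y = 0) \<Longrightarrow> X = 0"
    using assms by (auto simp: pseudo_metric_def)
  define A where "A X = (\<Sum>b\<in>Basis. g X b *\<^sub>R b)" for X
  have lin: "linear A"
    using bil unfolding A_def bilinear_def
    by (intro linear_compose_sum) (auto simp: linear_iff algebra_simps)
  have g_eq: "A X \<bullet> Y = g X Y" for X Y
  proof -
    have l: "linear (g X)" using bil by (simp add: bilinear_def)
    have "g X Y = g X (\<Sum>b\<in>Basis. (Y \<bullet> b) *\<^sub>R b)" by (simp add: euclidean_representation)
    also have "\<dots> = (\<Sum>b\<in>Basis. (Y \<bullet> b) * g X b)"
      by (simp add: linear_sum[OF l] linear_cmul[OF l])
    finally show ?thesis
      by (simp add: A_def inner_sum_left inner_commute[of _ Y] inner_sum_right mult.commute)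
  qed
  have "inj A"
    unfolding linear_injective_0[OF lin] using g_eq nd by (metis inner_zero_left)
  then have surj: "surj A" using lin linear_injective_imp_surjective by blast
  have "inj (flat g)"
  proof (rule injI)
    fix X Y assume "flat g X = flat g Y"
    then have "A X \<bullet> Z = A Y \<bullet> Z" for Z
      using blinfun_apply_flat[OF assms] g_eq by metis
    then have "A X = A Y" by (metis vector_eq_ldot inner_commute)
    then show "X = Y" using \<open>inj A\<close> by (simp add: inj_eq)
  qed
  moreover have "\<exists>X. \<xi> = flat g X" for \<xi>
  proof -
    obtain X where X: "A X = (\<Sum>b\<in>Basis. blinfun_apply \<xi> b *\<^sub>R b)"
      using surj by (metis surjD)
    have "blinfun_apply \<xi> Y = g X Y" for Y
    proof -
      have "blinfun_apply \<xi> Y = blinfun_apply \<xi> (\<Sum>b\<in>Basis. (Y \<bullet> b) *\<^sub>R b)"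
        by (simp add: euclidean_representation)
      also have "\<dots> = A X \<bullet> Y"
        by (simp add: X blinfun.sum_right blinfun.scaleR_right inner_sum_right
            inner_commute[of _ Y] mult.commute)
      finally show ?thesis by (simp add: g_eq)
    qed
    then show ?thesis
      using blinfun_apply_flat[OF assms] by (auto intro!: exI[of _ X] blinfun_eqI)
  qed
  ultimately show ?thesis by (auto simp: bij_def surj_def)
qed

text \<open>
  The involution \<open>F\<close> associated with \<open>gen_metric g\<close> is determined by
  \<open>gen_metric g u v = pairing (F u) v\<close>; the following facts say that \<open>E_plus g\<close> and \<open>E_minus g\<close> are
  its eigenspaces.
\<close>

definition gen_involution :: "('a::euclidean_space \<Rightarrow> 'a \<Rightarrow> real) \<Rightarrow> 'a gtb \<Rightarrow> 'a gtb" where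
  "gen_involution g u = (inv (flat g) (snd u), flat g (fst u))"

lemma gen_metric_eq_pairing:
  assumes "pseudo_metric g"
  shows "gen_metric g u v = pairing (gen_involution g u) v"
proof -
  have "g (inv (flat g) (snd u)) (inv (flat g) (snd v)) =
        g (inv (flat g) (snd v)) (inv (flat g) (snd u))"
    using assms by (simp add: pseudo_metric_def)
  also have "\<dots> = blinfun_apply (flat g (inv (flat g) (snd v))) (inv (flat g) (snd u))"
    by (simp add: blinfun_apply_flat[OF assms])
  also have "\<dots> = blinfun_apply (snd v) (inv (flat g) (snd u))"
    by (simp add: surj_f_inv_f bij_is_surj[OF bij_flat[OF assms]])
  finally show ?thesis
    by (simp add: gen_metric_def pairing_def gen_involution_def blinfun_apply_flat[OF assms])
qed

lemma flat_uminus: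
  assumes "pseudo_metric g"
  shows "flat g (- X) = - flat g X"
proof (rule blinfun_eqI)
  fix Y
  have "linear (\<lambda>X. g X Y)" using assms by (simp add: pseudo_metric_def bilinear_def)
  then show "blinfun_apply (flat g (- X)) Y = blinfun_apply (- flat g X) Y"
    using linear_neg[of "\<lambda>X. g X Y" X]
    by (simp add: blinfun_apply_flat[OF assms] blinfun.minus_left)
qed

lemma eigenspaces_gen_involution:
  assumes "pseudo_metric g"
  shows "E_plus g = {u. gen_involution g u = u}" "E_minus g = {u. gen_involution g u = - u}"
proof -
  have inj: "inv (flat g) (flat g X) = X" and surj: "flat g (inv (flat g) \<xi>) = \<xi>" for X \<xi>
    using bij_flat[OF assms] by (auto simp: bij_is_inj surj_f_inv_f bij_is_surj)
  have inj': "inv (flat g) (- flat g X) = - X" for X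
    using inj[of "- X"] by (simp add: flat_uminus[OF assms])
  show "E_plus g = {u. gen_involution g u = u}"
    by (auto simp: E_plus_def gen_involution_def inj)
  show "E_minus g = {u. gen_involution g u = - u}"
    by (force simp: E_minus_def gen_involution_def inj')
qed

definition pr_plus :: "('a::euclidean_space \<Rightarrow> 'a \<Rightarrow> real) \<Rightarrow> 'a gtb \<Rightarrow> 'a gtb" where
  "pr_plus g = proj_along (E_plus g) (E_minus g)"

definition pr_minus :: "('a::euclidean_space \<Rightarrow> 'a \<Rightarrow> real) \<Rightarrow> 'a gtb \<Rightarrow> 'a gtb" where
  "pr_minus g = proj_along (E_minus g) (E_plus g)"

section \<open>Generalized connections\<close>

definition gen_connection :: "('a::euclidean_space gtb \<Rightarrow> 'a gtb \<Rightarrow> 'a gtb) \<Rightarrow> bool" where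
  "gen_connection D \<longleftrightarrow> bilinear D \<and>
     (\<forall>u v w. pairing (D u v) w + pairing v (D u w) = 0)"

text \<open>The adjoint for \<open>pairing\<close>; the library constant \<open>adjoint\<close> refers to the inner product.\<close>

definition pairing_adjoint ::
  "('a::euclidean_space gtb \<Rightarrow> 'a gtb) \<Rightarrow> 'a gtb \<Rightarrow> 'a gtb" where
  "pairing_adjoint A = (THE A'. \<forall>u v. pairing (A u) v = pairing u (A' v))"

definition torsion ::
  "('a::euclidean_space \<Rightarrow> 'a \<Rightarrow> 'a) \<Rightarrow> ('a \<Rightarrow> 'a \<Rightarrow> 'a \<Rightarrow> real) \<Rightarrow>
   ('a gtb \<Rightarrow> 'a gtb \<Rightarrow> 'a gtb) \<Rightarrow> 'a gtb \<Rightarrow> 'a gtb \<Rightarrow> 'a gtb" where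
  "torsion br H D u v = D u v - D v u - dorfman br H u v + pairing_adjoint (\<lambda>w. D w u) v"

definition levi_civita ::
  "('a::euclidean_space \<Rightarrow> 'a \<Rightarrow> 'a) \<Rightarrow> ('a \<Rightarrow> 'a \<Rightarrow> 'a \<Rightarrow> real) \<Rightarrow> ('a \<Rightarrow> 'a \<Rightarrow> real) \<Rightarrow>
   ('a gtb \<Rightarrow> 'a gtb \<Rightarrow> 'a gtb) \<Rightarrow> bool" where
  "levi_civita br H g D \<longleftrightarrow> gen_connection D \<and>
     (\<forall>u v. torsion br H D u v = 0) \<and>
     (\<forall>u. D u ` E_plus g \<subseteq> E_plus g \<and> D u ` E_minus g \<subseteq> E_minus g)"

definition divergence :: "('a::euclidean_space gtb \<Rightarrow> 'a gtb \<Rightarrow> 'a gtb) \<Rightarrow> 'a gtb \<Rightarrow> real" where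
  "divergence D v = trace_on UNIV (\<lambda>u. D u v)"

definition curvature ::
  "('a::euclidean_space \<Rightarrow> 'a \<Rightarrow> 'a) \<Rightarrow> ('a \<Rightarrow> 'a \<Rightarrow> 'a \<Rightarrow> real) \<Rightarrow>
   ('a gtb \<Rightarrow> 'a gtb \<Rightarrow> 'a gtb) \<Rightarrow> 'a gtb \<Rightarrow> 'a gtb \<Rightarrow> 'a gtb \<Rightarrow> 'a gtb" where
  "curvature br H D u v w = D u (D v w) - D v (D u w) - D (dorfman br H u v) w"

section \<open>Generalized Ricci curvature\<close>

definition chosen_connection ::
  "('a::euclidean_space \<Rightarrow> 'a \<Rightarrow> 'a) \<Rightarrow> ('a \<Rightarrow> 'a \<Rightarrow> 'a \<Rightarrow> real) \<Rightarrow> ('a \<Rightarrow> 'a \<Rightarrow> real) \<Rightarrow>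
   ('a gtb \<Rightarrow> real) \<Rightarrow> 'a gtb \<Rightarrow> 'a gtb \<Rightarrow> 'a gtb" where
  "chosen_connection br H g \<delta> = (SOME D. levi_civita br H g D \<and> divergence D = \<delta>)"

definition ric_plus ::
  "('a::euclidean_space \<Rightarrow> 'a \<Rightarrow> 'a) \<Rightarrow> ('a \<Rightarrow> 'a \<Rightarrow> 'a \<Rightarrow> real) \<Rightarrow> ('a \<Rightarrow> 'a \<Rightarrow> real) \<Rightarrow>
   ('a gtb \<Rightarrow> real) \<Rightarrow> 'a gtb \<Rightarrow> 'a gtb \<Rightarrow> real" where
  "ric_plus br H g \<delta> um up =
     trace_on (E_plus g) (\<lambda>w. curvature br H (chosen_connection br H g \<delta>) w um up)"

definition ric_minus ::
  "('a::euclidean_space \<Rightarrow> 'a \<Rightarrow> 'a) \<Rightarrow> ('a \<Rightarrow> 'a \<Rightarrow> 'a \<Rightarrow> real) \<Rightarrow> ('a \<Rightarrow> 'a \<Rightarrow> real) \<Rightarrow>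
   ('a gtb \<Rightarrow> real) \<Rightarrow> 'a gtb \<Rightarrow> 'a gtb \<Rightarrow> real" where
  "ric_minus br H g \<delta> up um =
     trace_on (E_minus g) (\<lambda>w. curvature br H (chosen_connection br H g \<delta>) w up um)"

text \<open>
  \<open>ric_plus\<close> is a form on \<open>E_minus g \<times> E_plus g\<close> and \<open>ric_minus\<close> one on \<open>E_plus g \<times> E_minus g\<close>;
  their sum is extended by zero on the two remaining blocks.
\<close>

definition gen_ricci ::
  "('a::euclidean_space \<Rightarrow> 'a \<Rightarrow> 'a) \<Rightarrow> ('a \<Rightarrow> 'a \<Rightarrow> 'a \<Rightarrow> real) \<Rightarrow> ('a \<Rightarrow> 'a \<Rightarrow> real) \<Rightarrow>
   ('a gtb \<Rightarrow> real) \<Rightarrow> 'a gtb \<Rightarrow> 'a gtb \<Rightarrow> real" where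
  "gen_ricci br H g \<delta> u v =
     ric_plus br H g \<delta> (pr_minus g u) (pr_plus g v) +
     ric_minus br H g \<delta> (pr_plus g u) (pr_minus g v)"

text \<open>
  \<open>Gamma_plus br H g u\<close> is used for \<open>u\<close> in \<open>E_plus g\<close> as a map from \<open>E_minus g\<close> to \<open>E_plus g\<close>,
  and \<open>Gamma_minus\<close> with the roles exchanged.
\<close>

definition Gamma_plus ::
  "('a::euclidean_space \<Rightarrow> 'a \<Rightarrow> 'a) \<Rightarrow> ('a \<Rightarrow> 'a \<Rightarrow> 'a \<Rightarrow> real) \<Rightarrow> ('a \<Rightarrow> 'a \<Rightarrow> real) \<Rightarrow>
   'a gtb \<Rightarrow> 'a gtb \<Rightarrow> 'a gtb" where
  "Gamma_plus br H g u = restrict (pr_plus g \<circ> dorfman br H u) (E_minus g)"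

definition Gamma_minus ::
  "('a::euclidean_space \<Rightarrow> 'a \<Rightarrow> 'a) \<Rightarrow> ('a \<Rightarrow> 'a \<Rightarrow> 'a \<Rightarrow> real) \<Rightarrow> ('a \<Rightarrow> 'a \<Rightarrow> real) \<Rightarrow>
   'a gtb \<Rightarrow> 'a gtb \<Rightarrow> 'a gtb" where
  "Gamma_minus br H g u = restrict (pr_minus g \<circ> dorfman br H u) (E_plus g)"

end

theory Submission
  imports Defs
begin

text \<open>
  Vanishing torsion of \<open>D\<close> means that the cyclic sum of \<open>\<langle>D\<^sub>u v, w\<rangle>\<close> is the totally skew form
  \<open>\<langle>[u,v]\<^sub>H, w\<rangle>\<close>. As \<open>D\<close> preserves the orthogonal summands \<open>E\<^sub>+\<close> and \<open>E\<^sub>-\<close>, this determines the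
  mixed part: \<open>D\<^sub>u v\<close> is the projection of \<open>[u,v]\<^sub>H\<close> to \<open>E\<^sub>+\<close> for \<open>u\<close> in \<open>E\<^sub>-\<close> and \<open>v\<close> in \<open>E\<^sub>+\<close>, and likewise
  with the signs exchanged. Substituting this into the curvature \<open>R(w,a)b\<close>, the undetermined pure part
  of \<open>D\<close> enters the trace over \<open>w\<close> only through the divergence and through the trace of a commutator,
  which vanishes. Since the Ricci curvature is defined by a chosen connection, one also needs that a
  Levi-Civita generalized connection with the given divergence exists; the divergence of one
  such connection is adjusted by a torsion-free tensor with prescribed trace.
\<close>

section \<open>Traces on subspaces\<close>


text \<open>A finitely spanned space has a basis, so the choice in \<open>trace_on\<close> is
  meaningful and yields a finite basis. One basis serves for all \<open>f\<close>, hence traces of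
  different maps on \<open>V\<close> can be compared termwise.\<close>

lemma trace_on_basis:
  assumes "finite S" "span S = V"
  obtains B where "finite B" "independent B" "span B = V"
    "\<And>f. trace_on V f = (\<Sum>b\<in>B. representation B (f b) b)"
proof -
  let ?P = "\<lambda>B. independent B \<and> span B = V"
  obtain B0 where "B0 \<subseteq> V" "independent B0" "V \<subseteq> span B0"
    by (rule real_vector.basis_exists)
  moreover have "span B0 \<subseteq> V"
    using \<open>B0 \<subseteq> V\<close> assms(2) by (metis real_vector.span_mono real_vector.span_span)
  ultimately have "?P B0" by auto
  then have *: "?P (SOME B. ?P B)" by (rule someI)
  then have "finite (SOME B. ?P B)"
    using assms real_vector.independent_span_bound[of S "SOME B. ?P B"]
      real_vector.span_superset by metis
  with * show ?thesis
    by (intro that[of "SOME B. ?P B"]) (auto simp: trace_on_def Let_def)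
qed

lemma trace_on_cong:
  assumes "finite S" "span S = V" "\<And>v. v \<in> V \<Longrightarrow> f v = h v"
  shows "trace_on V f = trace_on V h"
proof -
  obtain B where B: "span B = V" "\<And>f. trace_on V f = (\<Sum>b\<in>B. representation B (f b) b)"
    using trace_on_basis[OF assms(1,2)] by metis
  show ?thesis unfolding B(2) using B(1) assms(3) by (auto intro!: sum.cong simp: real_vector.span_base)
qed

lemma trace_on_zero: "trace_on V (\<lambda>v. 0) = 0"
  by (simp add: trace_on_def Let_def real_vector.representation_zero)

lemma trace_on_add:
  assumes "finite S" "span S = V" "f ` V \<subseteq> V" "h ` V \<subseteq> V"
  shows "trace_on V (\<lambda>v. f v + h v) = trace_on V f + trace_on V h"
proof -
  obtain B where B: "independent B" "span B = V"
      "\<And>f. trace_on V f = (\<Sum>b\<in>B. representation B (f b) b)"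
    using trace_on_basis[OF assms(1,2)] by metis
  have "f b \<in> span B" "h b \<in> span B" if "b \<in> B" for b
    using that B(2) assms(3,4) real_vector.span_base[OF that] by auto
  then show ?thesis
    unfolding B(3) by (simp add: real_vector.representation_add[OF B(1)] sum.distrib)
qed

lemma trace_on_scaleR:
  assumes "finite S" "span S = V" "f ` V \<subseteq> V"
  shows "trace_on V (\<lambda>v. c *\<^sub>R f v) = c * trace_on V f"
proof -
  obtain B where B: "independent B" "span B = V"
      "\<And>f. trace_on V f = (\<Sum>b\<in>B. representation B (f b) b)"
    using trace_on_basis[OF assms(1,2)] by metis
  have "f b \<in> span B" if "b \<in> B" for b
    using that B(2) assms(3) real_vector.span_base[OF that] by auto
  then show ?thesis
    unfolding B(3) by (simp add: real_vector.representation_scale[OF B(1)] sum_distrib_left)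
qed

lemma trace_on_diff:
  assumes "finite S" "span S = V" "f ` V \<subseteq> V" "h ` V \<subseteq> V"
  shows "trace_on V (\<lambda>v. f v - h v) = trace_on V f - trace_on V h"
proof -
  obtain B where B: "independent B" "span B = V"
      "\<And>f. trace_on V f = (\<Sum>b\<in>B. representation B (f b) b)"
    using trace_on_basis[OF assms(1,2)] by metis
  have "f b \<in> span B" "h b \<in> span B" if "b \<in> B" for b
    using that B(2) assms(3,4) real_vector.span_base[OF that] by auto
  then show ?thesis
    unfolding B(3) by (simp add: real_vector.representation_diff[OF B(1)] sum_subtractf)
qed

lemma trace_on_ident:
  assumes "finite S" "span S = V"
  shows "trace_on V (\<lambda>v. v) = dim V"
proof -
  obtain B where B: "independent B" "span B = V"
      "\<And>f. trace_on V f = (\<Sum>b\<in>B. representation B (f b) b)"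
    using trace_on_basis[OF assms(1,2)] by metis
  have "dim V = card B"
    using B(1,2) real_vector.dim_span_eq_card_independent by blast
  then show ?thesis
    unfolding B(3) by (simp add: real_vector.representation_basis[OF B(1)])
qed

lemma trace_on_rank_one:
  assumes "finite S" "span S = V" "linear \<phi>" "e \<in> V"
  shows "trace_on V (\<lambda>v. \<phi> v *\<^sub>R e) = \<phi> e"
proof -
  obtain B where B: "finite B" "independent B" "span B = V"
      "\<And>f. trace_on V f = (\<Sum>b\<in>B. representation B (f b) b)"
    using trace_on_basis[OF assms(1,2)] by metis
  have e: "e \<in> span B" using assms(4) B(3) by simp
  have "\<phi> e = \<phi> (\<Sum>b\<in>B. representation B e b *\<^sub>R b)"
    using real_vector.sum_representation_eq[OF B(2) e B(1)] by simp
  then show ?thesis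
    unfolding B(4) real_vector.representation_scale[OF B(2) e]
    by (simp add: linear_sum[OF assms(3)] linear_cmul[OF assms(3)] mult.commute)
qed

text \<open>In the two chosen bases both traces become the same double sum of products of matrix
  entries. Allowing \<open>V\<close> and \<open>W\<close> to differ covers inclusions and the
  exchange of \<open>E_plus g\<close> and \<open>E_minus g\<close>.\<close>

lemma trace_on_commute:
  fixes f :: "'v::real_vector \<Rightarrow> 'w::real_vector" and h :: "'w \<Rightarrow> 'v"
  assumes "finite S" "span S = V" "finite T" "span T = W"
    and "linear f" "linear h" "f ` V \<subseteq> W" "h ` W \<subseteq> V"
  shows "trace_on V (h \<circ> f) = trace_on W (f \<circ> h)"
proof -
  obtain B where B: "finite B" "independent B" "span B = V"
      "\<And>f. trace_on V f = (\<Sum>b\<in>B. representation B (f b) b)"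
    using trace_on_basis[OF assms(1,2)] by metis
  obtain C where C: "finite C" "independent C" "span C = W"
      "\<And>f. trace_on W f = (\<Sum>b\<in>C. representation C (f b) b)"
    using trace_on_basis[OF assms(3,4)] by metis
  have fB: "f b \<in> span C" if "b \<in> B" for b
    using that B(3) C(3) assms(7) real_vector.span_base[OF that] by auto
  have hC: "h c \<in> span B" if "c \<in> C" for c
    using that B(3) C(3) assms(8) real_vector.span_base[OF that] by auto
  have *: "representation B (h (f b)) b = (\<Sum>c\<in>C. representation C (f b) c * representation B (h c) b)"
    if "b \<in> B" for b
  proof -
    have "h (f b) = h (\<Sum>c\<in>C. representation C (f b) c *\<^sub>R c)"
      using real_vector.sum_representation_eq[OF C(2) fB[OF that] C(1)] by simp
    also have "\<dots> = (\<Sum>c\<in>C. representation C (f b) c *\<^sub>R h c)"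
      by (simp add: linear_sum[OF assms(6)] linear_cmul[OF assms(6)])
    finally show ?thesis
      by (simp add: real_vector.representation_sum[OF B(2)] real_vector.span_scale hC
          real_vector.representation_scale[OF B(2)])
  qed
  have **: "representation C (f (h c)) c = (\<Sum>b\<in>B. representation B (h c) b * representation C (f b) c)"
    if "c \<in> C" for c
  proof -
    have "f (h c) = f (\<Sum>b\<in>B. representation B (h c) b *\<^sub>R b)"
      using real_vector.sum_representation_eq[OF B(2) hC[OF that] B(1)] by simp
    also have "\<dots> = (\<Sum>b\<in>B. representation B (h c) b *\<^sub>R f b)"
      by (simp add: linear_sum[OF assms(5)] linear_cmul[OF assms(5)])
    finally show ?thesis
      by (simp add: real_vector.representation_sum[OF C(2)] real_vector.span_scale fB
          real_vector.representation_scale[OF C(2)])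
  qed
  have "trace_on V (h \<circ> f) =
      (\<Sum>b\<in>B. \<Sum>c\<in>C. representation C (f b) c * representation B (h c) b)"
    unfolding B(4) by (rule sum.cong) (simp_all only: o_apply *)
  also have "\<dots> = (\<Sum>c\<in>C. \<Sum>b\<in>B. representation B (h c) b * representation C (f b) c)"
    by (subst sum.swap) (simp only: mult.commute)
  also have "\<dots> = trace_on W (f \<circ> h)"
    unfolding C(4) by (rule sum.cong) (simp_all only: o_apply **)
  finally show ?thesis .
qed

text \<open>Cyclicity, applied to \<open>f\<close> followed by the inclusion of \<open>V\<close>.
  Divergences are traces over the whole space while curvature traces run over a summand; this
  connects the two.\<close>

lemma trace_on_UNIV_eq:
  fixes f :: "'v::real_vector \<Rightarrow> 'v"
  assumes "finite S" "span S = V" "finite T" "span T = (UNIV :: 'v set)"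
    and "linear f" "range f \<subseteq> V"
  shows "trace_on UNIV f = trace_on V f"
proof -
  have "trace_on UNIV (id \<circ> f) = trace_on V (f \<circ> id)"
    by (rule trace_on_commute[OF assms(3,4,1,2,5) linear_id assms(6)]) simp
  then show ?thesis by simp
qed

section \<open>The pairing and the Dorfman bracket\<close>


lemma pairing_commute: "pairing u v = pairing v u"
  by (simp add: pairing_def add.commute)

lemma bilinear_pairing: "bilinear pairing"
  by (auto simp: bilinear_def linear_iff pairing_def blinfun.bilinear_simps field_simps)

lemmas pairing_simps =
  bilinear_ladd[OF bilinear_pairing] bilinear_radd[OF bilinear_pairing]
  bilinear_lmul[OF bilinear_pairing] bilinear_rmul[OF bilinear_pairing]
  bilinear_lneg[OF bilinear_pairing] bilinear_rneg[OF bilinear_pairing]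
  bilinear_lsub[OF bilinear_pairing] bilinear_rsub[OF bilinear_pairing]
  bilinear_lzero[OF bilinear_pairing] bilinear_rzero[OF bilinear_pairing]

text \<open>Elements \<open>(X, 0)\<close> detect the form part of \<open>u\<close>, elements
  \<open>(0, blinfun_inner_left X)\<close> its vector part.\<close>

lemma pairing_nondegenerate:
  assumes "\<And>v. pairing u v = 0"
  shows "u = 0"
proof -
  have "blinfun_apply (snd u) X = 0" for X
    using assms[of "(X, 0)"] by (simp add: pairing_def)
  then have "snd u = 0" by (simp add: blinfun_eqI)
  moreover have "fst u \<bullet> X = 0" for X
    using assms[of "(0, blinfun_inner_left X)"] by (simp add: pairing_def)
  then have "fst u = 0" by (metis inner_eq_zero_iff)
  ultimately show ?thesis by (simp add: prod_eq_iff)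
qed

lemma pairing_eqI: "(\<And>w. pairing u w = pairing v w) \<Longrightarrow> u = v"
  using pairing_nondegenerate[of "u - v"] by (simp add: pairing_simps)

text \<open>The forms \<open>blinfun_inner_left b\<close> are the basis dual to
  \<open>Basis\<close>.\<close>

lemma blinfun_eq_sum_inner:
  fixes \<xi> :: "'a::euclidean_space \<Rightarrow>\<^sub>L real"
  shows "\<xi> = (\<Sum>b\<in>Basis. blinfun_apply \<xi> b *\<^sub>R blinfun_inner_left b)"
proof (rule blinfun_eqI)
  fix X
  have "blinfun_apply \<xi> X = blinfun_apply \<xi> (\<Sum>b\<in>Basis. (X \<bullet> b) *\<^sub>R b)"
    by (simp add: euclidean_representation)
  then show "blinfun_apply \<xi> X =
      blinfun_apply (\<Sum>b\<in>Basis. blinfun_apply \<xi> b *\<^sub>R blinfun_inner_left b) X"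
    by (simp add: blinfun.bilinear_simps blinfun.sum_left blinfun.sum_right
        inner_commute mult.commute)
qed

text \<open>The values on forms determine the vector part of \<open>e\<close>, and the values on
  vectors its form part; the factors 2 undo the division in \<open>pairing\<close>.\<close>

lemma pairing_representation:
  fixes \<phi> :: "'a::euclidean_space gtb \<Rightarrow> real"
  assumes "linear \<phi>"
  obtains e where "\<And>v. \<phi> v = pairing e v"
proof -
  define Y :: 'a where "Y = (\<Sum>b\<in>Basis. (2 * \<phi> (0, blinfun_inner_left b)) *\<^sub>R b)"
  define \<eta> :: "'a \<Rightarrow>\<^sub>L real" where "\<eta> = Blinfun (\<lambda>X. 2 * \<phi> (X, 0))"
  have l1: "linear (\<lambda>X::'a. (X, 0::'a \<Rightarrow>\<^sub>L real))" and l2: "linear (\<lambda>\<xi>::'a \<Rightarrow>\<^sub>L real. (0::'a, \<xi>))"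
    by (auto simp: linear_iff)
  note p1 = linear_compose[OF l1 assms, unfolded o_def]
    and p2 = linear_compose[OF l2 assms, unfolded o_def]
  have "bounded_linear (\<lambda>X. 2 * \<phi> (X, 0))"
    using p1 linear_conv_bounded_linear linear_compose_scale_right[of _ 2] by fastforce
  then have \<eta>: "blinfun_apply \<eta> X = 2 * \<phi> (X, 0)" for X
    by (simp add: \<eta>_def bounded_linear_Blinfun_apply)
  have "2 * \<phi> (0, \<xi>) = blinfun_apply \<xi> Y" for \<xi>
  proof -
    have "\<phi> (0, \<xi>) = \<phi> (0, \<Sum>b\<in>Basis. blinfun_apply \<xi> b *\<^sub>R blinfun_inner_left b)"
      using blinfun_eq_sum_inner[of \<xi>] by simp
    also have "\<dots> = (\<Sum>b\<in>Basis. blinfun_apply \<xi> b * \<phi> (0, blinfun_inner_left b))"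
      by (simp add: linear_sum[OF p2] linear_cmul[OF p2])
    finally show ?thesis
      by (simp add: Y_def blinfun.bilinear_simps blinfun.sum_right sum_distrib_left mult.commute mult.left_commute)
  qed
  note \<xi> = this
  have "\<phi> v = pairing (Y, \<eta>) v" for v
  proof -
    have "\<phi> v = \<phi> (fst v, 0) + \<phi> (0, snd v)"
      using linear_add[OF assms, of "(fst v, 0)" "(0, snd v)"] by simp
    moreover have "pairing (Y, \<eta>) v = (blinfun_apply \<eta> (fst v) + blinfun_apply (snd v) Y) / 2"
      by (simp add: pairing_def)
    ultimately show ?thesis using \<eta>[of "fst v"] \<xi>[of "snd v"] by argo
  qed
  then show ?thesis by (rule that)
qed

text \<open>Representability of linear forms gives an adjoint and nondegeneracy makes it unique, so
  the definite description denotes it.\<close>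

lemma pairing_adjoint:
  assumes "linear A"
  shows "pairing (A u) v = pairing u (pairing_adjoint A v)"
proof -
  have "\<exists>e. \<forall>u. pairing (A u) v = pairing u e" for v
  proof -
    have "linear (\<lambda>u. pairing (A u) v)"
      using assms by (auto simp: linear_iff pairing_simps)
    then show ?thesis using pairing_representation pairing_commute by metis
  qed
  then obtain A' where A': "\<forall>u v. pairing (A u) v = pairing u (A' v)" by metis
  have "A'' = A'" if *: "\<forall>u v. pairing (A u) v = pairing u (A'' v)" for A''
  proof (rule ext, rule pairing_eqI)
    show "pairing (A'' v) w = pairing (A' v) w" for v w
      using * A' by (metis pairing_commute)
  qed
  with A' have "pairing_adjoint A = A'"
    unfolding pairing_adjoint_def by (intro the_equality) auto
  with A' show ?thesis by metis
qed

section \<open>Total skew-symmetry of the Dorfman bracket form\<close>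

lemma lie_bracket_linear:
  assumes "lie_bracket br"
  shows "linear (\<lambda>X. br X Y)" "linear (br X)"
  using assms by (auto simp: lie_bracket_def bilinear_def)

lemma three_form_linear:
  assumes "three_form H"
  shows "linear (\<lambda>X. H X Y Z)" "linear (\<lambda>Y. H X Y Z)" "linear (H X Y)"
  using assms unfolding three_form_def by blast+

text \<open>\<open>Blinfun\<close> returns the given function only if that function is bounded
  linear; in finite dimension linearity in \<open>Z\<close> suffices.\<close>

lemma blinfun_apply_dorfman:
  assumes "lie_bracket br" "three_form H"
  shows "blinfun_apply (snd (dorfman br H u v)) Z =
    - blinfun_apply (snd v) (br (fst u) Z) + blinfun_apply (snd u) (br (fst v) Z) + H (fst u) (fst v) Z"
proof -
  have "linear (\<lambda>Z. - blinfun_apply (snd v) (br (fst u) Z) + blinfun_apply (snd u) (br (fst v) Z)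
      + H (fst u) (fst v) Z)"
    using lie_bracket_linear[OF assms(1)] three_form_linear[OF assms(2)]
    by (auto simp: linear_iff blinfun.bilinear_simps algebra_simps)
  then show ?thesis
    by (simp add: dorfman_def bounded_linear_Blinfun_apply linear_conv_bounded_linear)
qed

lemma lie_bracket_skew:
  assumes "lie_bracket br"
  shows "br X Y = - br Y X"
proof -
  have "bilinear br" "br (X + Y) (X + Y) = 0" "br X X = 0" "br Y Y = 0"
    using assms by (auto simp: lie_bracket_def)
  then have "br X Y + br Y X = 0"
    by (simp add: bilinear_ladd bilinear_radd)
  then show ?thesis by (simp add: eq_neg_iff_add_eq_0)
qed

text \<open>The three bracket terms are cyclic rotations of one another; in this shape the symmetry
  in \<open>u\<close>, \<open>v\<close>, \<open>w\<close> is visible.\<close>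

lemma pairing_dorfman:
  assumes "lie_bracket br" "three_form H"
  shows "pairing (dorfman br H u v) w =
    (blinfun_apply (snd u) (br (fst v) (fst w)) + blinfun_apply (snd v) (br (fst w) (fst u))
      + blinfun_apply (snd w) (br (fst u) (fst v)) + H (fst u) (fst v) (fst w)) / 2"
  by (simp add: pairing_def blinfun_apply_dorfman[OF assms] blinfun.bilinear_simps
      lie_bracket_skew[OF assms(1), of "fst u" "fst w"])
    (simp add: dorfman_def)

text \<open>The two transpositions generate all permutations of the arguments, so the form is
  totally skew.\<close>

lemma pairing_dorfman_skew:
  assumes "lie_bracket br" "three_form H"
  shows "pairing (dorfman br H v u) w = - pairing (dorfman br H u v) w"
    "pairing (dorfman br H u w) v = - pairing (dorfman br H u v) w"
proof -
  have H: "H Y X Z = - H X Y Z" "H X Z Y = - H X Y Z" for X Y Z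
    using assms(2) by (metis three_form_def)+
  note s = lie_bracket_skew[OF assms(1)]
  show "pairing (dorfman br H v u) w = - pairing (dorfman br H u v) w"
    unfolding pairing_dorfman[OF assms] H(1)[where X = "fst u"]
      s[of "fst u" "fst w"] s[of "fst w" "fst v"] s[of "fst v" "fst u"]
      blinfun.minus_right by argo
  show "pairing (dorfman br H u w) v = - pairing (dorfman br H u v) w"
    unfolding pairing_dorfman[OF assms] H(2)[where Y = "fst v"]
      s[of "fst u" "fst w"] s[of "fst w" "fst v"] s[of "fst v" "fst u"]
      blinfun.minus_right by argo
qed

lemma dorfman_skew:
  assumes "lie_bracket br" "three_form H"
  shows "dorfman br H v u = - dorfman br H u v"
  by (rule pairing_eqI) (simp add: pairing_simps pairing_dorfman_skew(1)[OF assms, of u v])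

lemma bilinear_dorfman:
  assumes "lie_bracket br" "three_form H"
  shows "bilinear (dorfman br H)"
proof -
  note lin = lie_bracket_linear[OF assms(1)] three_form_linear[OF assms(2)]
  have add: "dorfman br H (x + y) z = dorfman br H x z + dorfman br H y z" for x y z
    by (rule pairing_eqI)
      (simp only: pairing_simps pairing_dorfman[OF assms] fst_add snd_add blinfun.add_left
        blinfun.add_right lin[THEN linear_add], argo)
  have scale: "dorfman br H (c *\<^sub>R x) z = c *\<^sub>R dorfman br H x z" for c x z
    by (rule pairing_eqI)
      (simp add: pairing_simps pairing_dorfman[OF assms] blinfun.scaleR_left blinfun.scaleR_right
        lin[THEN linear_cmul] algebra_simps)
  have "linear (\<lambda>x. dorfman br H x z)" for z
    by (rule linearI) (rule add, rule scale)
  moreover have "dorfman br H z = (\<lambda>x. - dorfman br H x z)" for z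
    by (rule ext) (rule dorfman_skew[OF assms])
  ultimately show ?thesis
    unfolding bilinear_def by (metis linear_compose_neg)
qed

section \<open>Levi-Civita connections of a splitting\<close>


lemma gen_connection_skew:
  "gen_connection D \<Longrightarrow> pairing v (D u w) = - pairing (D u v) w"
  unfolding gen_connection_def by (metis add.inverse_unique)

text \<open>The adjoint contributes the term with \<open>D w u\<close>, and metricity turns the one
  with \<open>- D v u\<close> into the one with \<open>D v w\<close>. This makes the part of the
  torsion coming from \<open>D\<close> a cyclic sum.\<close>

lemma pairing_torsion:
  assumes "gen_connection D"
  shows "pairing (torsion br H D u v) w =
    pairing (D u v) w + pairing (D v w) u + pairing (D w u) v - pairing (dorfman br H u v) w"
proof -
  have "linear (\<lambda>w. D w u)"
    using assms unfolding gen_connection_def bilinear_def by blast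
  then have "pairing (pairing_adjoint (\<lambda>w. D w u) v) w = pairing (D w u) v"
    using pairing_adjoint pairing_commute by metis
  moreover have "pairing (D v w) u = - pairing (D v u) w"
    using gen_connection_skew[OF assms] pairing_commute by metis
  ultimately show ?thesis
    by (simp add: torsion_def pairing_simps)
qed

text \<open>Symmetric in \<open>V\<close> and \<open>W\<close>, so that an argument for one sign
  applies to the other.\<close>

definition split_levi_civita ::
  "('a::euclidean_space \<Rightarrow> 'a \<Rightarrow> 'a) \<Rightarrow> ('a \<Rightarrow> 'a \<Rightarrow> 'a \<Rightarrow> real) \<Rightarrow>
   'a gtb set \<Rightarrow> 'a gtb set \<Rightarrow> ('a gtb \<Rightarrow> 'a gtb \<Rightarrow> 'a gtb) \<Rightarrow> bool" where
  "split_levi_civita br H V W D \<longleftrightarrow> gen_connection D \<and> (\<forall>u v. torsion br H D u v = 0) \<and>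
     (\<forall>u. D u ` V \<subseteq> V \<and> D u ` W \<subseteq> W)"

lemma levi_civita_iff_split:
  "levi_civita br H g D \<longleftrightarrow> split_levi_civita br H (E_plus g) (E_minus g) D"
  by (simp only: levi_civita_def split_levi_civita_def)

lemma split_levi_civita_swap: "split_levi_civita br H V W D \<Longrightarrow> split_levi_civita br H W V D"
  by (simp only: split_levi_civita_def simp_thms)

lemma split_levi_civitaD:
  assumes "split_levi_civita br H V W D"
  shows "gen_connection D" "bilinear D" "torsion br H D u v = 0"
    "v \<in> V \<Longrightarrow> D u v \<in> V" "v \<in> W \<Longrightarrow> D u v \<in> W"
  using assms unfolding split_levi_civita_def gen_connection_def by blast+

text \<open>
  \<open>V\<close> and \<open>W\<close> stand for \<open>E_plus g\<close> and \<open>E_minus g\<close> in either order, so that the two signs are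
  treated by the same lemmas.
\<close>

locale bracket_splitting =
  fixes V W :: "'a::euclidean_space gtb set"
    and br :: "'a \<Rightarrow> 'a \<Rightarrow> 'a"
    and H :: "'a \<Rightarrow> 'a \<Rightarrow> 'a \<Rightarrow> real"
  assumes subspace_left: "subspace V" and subspace_right: "subspace W"
    and decompose: "\<exists>v\<in>V. u - v \<in> W"
    and orthogonal: "\<lbrakk>v \<in> V; w \<in> W\<rbrakk> \<Longrightarrow> pairing v w = 0"
    and fin_left: "\<exists>S. finite S \<and> span S = V" and fin_right: "\<exists>S. finite S \<and> span S = W"
    and dim_left: "dim V = DIM('a)" and dim_right: "dim W = DIM('a)"
    and br: "lie_bracket br" and H: "three_form H"
begin

section \<open>Orthogonal projections of the splitting\<close>

abbreviation "p \<equiv> proj_along V W"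
abbreviation "q \<equiv> proj_along W V"
abbreviation "B \<equiv> dorfman br H"

text \<open>Facts about \<open>q\<close> and \<open>W\<close> are obtained from those about
  \<open>p\<close> and \<open>V\<close> by exchanging the summands.\<close>

lemma swap: "bracket_splitting W V br H"
proof
  fix u
  obtain v where "v \<in> V" "u - v \<in> W" using decompose by blast
  then show "\<exists>v\<in>W. u - v \<in> V" by (intro bexI[of _ "u - v"]) auto
next
  show "pairing v w = 0" if "v \<in> W" "w \<in> V" for v w
    using orthogonal[OF that(2,1)] pairing_commute by metis
qed (simp_all add: subspace_left subspace_right fin_left fin_right dim_left dim_right br H)

text \<open>The difference of two candidates lies in both summands, hence is orthogonal to both and
  so to everything; nondegeneracy makes it zero.\<close>

lemma proj_eqI:
  assumes "v \<in> V" "u - v \<in> W"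
  shows "p u = v"
  unfolding proj_along_def
proof (rule the_equality)
  fix v' assume v': "v' \<in> V \<and> u - v' \<in> W"
  have "v' - v \<in> V" using v' assms real_vector.subspace_diff[OF subspace_left] by blast
  moreover have "v' - v \<in> W"
    using real_vector.subspace_diff[OF subspace_right, of "u - v" "u - v'"] v' assms by simp
  ultimately have z: "pairing (v' - v) x = 0" for x
  proof -
    obtain y where "y \<in> V" "x - y \<in> W" using decompose by blast
    then have "pairing (v' - v) y = 0" "pairing (v' - v) (x - y) = 0"
      using \<open>v' - v \<in> V\<close> \<open>v' - v \<in> W\<close> orthogonal pairing_commute by metis+
    then show ?thesis by (simp add: pairing_simps)
  qed
  then show "v' = v" using pairing_nondegenerate[OF z] by simp
qed (use assms in simp)

lemma proj_mem [simp]: "p u \<in> V" and diff_proj_mem: "u - p u \<in> W"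
proof -
  obtain v where v: "v \<in> V" "u - v \<in> W" using decompose by blast
  with proj_eqI[OF v] show "p u \<in> V" "u - p u \<in> W" by auto
qed

lemma proj_id: "u \<in> V \<Longrightarrow> p u = u"
  by (rule proj_eqI) (simp_all add: real_vector.subspace_0[OF subspace_right])

lemma proj_zero: "u \<in> W \<Longrightarrow> p u = 0"
  by (rule proj_eqI) (simp_all add: real_vector.subspace_0[OF subspace_left])

lemma coproj_mem [simp]: "q u \<in> W"
  by (rule bracket_splitting.proj_mem[OF swap])

lemma coproj_eq: "q u = u - p u"
  by (rule bracket_splitting.proj_eqI[OF swap]) (simp_all add: diff_proj_mem)

lemma proj_add_coproj: "p u + q u = u"
  by (simp add: coproj_eq)

lemma linear_proj: "linear p"
proof (rule linearI)
  show "p (x + y) = p x + p y" for x y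
  proof (rule proj_eqI)
    have "(x - p x) + (y - p y) \<in> W"
      by (intro real_vector.subspace_add[OF subspace_right] diff_proj_mem)
    then show "x + y - (p x + p y) \<in> W" by (simp add: algebra_simps)
  qed (simp add: real_vector.subspace_add[OF subspace_left])
  show "p (c *\<^sub>R x) = c *\<^sub>R p x" for c x
  proof (rule proj_eqI)
    have "c *\<^sub>R (x - p x) \<in> W"
      by (intro real_vector.subspace_scale[OF subspace_right] diff_proj_mem)
    then show "c *\<^sub>R x - c *\<^sub>R p x \<in> W" by (simp add: algebra_simps)
  qed (simp add: real_vector.subspace_scale[OF subspace_left])
qed

lemma linear_coproj: "linear q"
  by (rule bracket_splitting.linear_proj[OF swap])

lemma pairing_proj_left: "pairing (p u) v = pairing (p u) (p v)"
  using orthogonal[OF proj_mem diff_proj_mem, of u v] by (simp add: pairing_simps)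

text \<open>Orthogonality of the summands makes the projection self-adjoint: both sides equal
  \<open>pairing (p u) (p v)\<close>.\<close>

lemma pairing_proj: "pairing (p u) v = pairing u (p v)"
  using pairing_proj_left pairing_commute by metis

lemma finite_UNIV_span: "\<exists>T. finite T \<and> span T = (UNIV :: 'a gtb set)"
proof -
  obtain S T where S: "finite S" "span S = V" and T: "finite T" "span T = W"
    using fin_left fin_right by blast
  have "u \<in> span (S \<union> T)" for u
  proof -
    have "p u \<in> span (S \<union> T)" "q u \<in> span (S \<union> T)"
      using S(2) T(2) proj_mem coproj_mem real_vector.span_mono
      by (metis Un_upper1 in_mono, metis Un_upper2 coproj_mem in_mono real_vector.span_mono)
    then show ?thesis using real_vector.span_add proj_add_coproj by metis
  qed
  then show ?thesis using S(1) T(1) by (intro exI[of _ "S \<union> T"]) auto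
qed

section \<open>Forced mixed components and the trace of the curvature\<close>

lemma dorfman_proj_split: "B u v = p (B u v) + q (B u v)"
  by (simp add: proj_add_coproj)

text \<open>Testing against \<open>p w\<close> is enough, since \<open>D u v\<close> lies in
  \<open>V\<close>. The other two terms of the cyclic sum then pair an element of \<open>V\<close>
  with one of \<open>W\<close> and vanish.\<close>

lemma connection_mixed:
  assumes D: "split_levi_civita br H V W D"
    and "u \<in> W" "v \<in> V"
  shows "D u v = p (B u v)"
proof (rule pairing_eqI)
  note conn = split_levi_civitaD(1)[OF D] and tor = split_levi_civitaD(3)[OF D]
    and invl = split_levi_civitaD(4)[OF D] and invr = split_levi_civitaD(5)[OF D]
  fix w
  have "pairing (D u v) w = pairing (D u v) (p w)"
    using invl[OF \<open>v \<in> V\<close>] proj_id pairing_proj by metis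
  also have "pairing (D v (p w)) u = 0" "pairing (D (p w) u) v = 0"
    using orthogonal \<open>u \<in> W\<close> \<open>v \<in> V\<close> invl invr proj_mem pairing_commute by metis+
  then have "pairing (D u v) (p w) = pairing (B u v) (p w)"
    using pairing_torsion[OF conn, of br H u v "p w"] tor by (simp add: pairing_simps)
  finally show "pairing (D u v) w = pairing (p (B u v)) w"
    by (simp add: pairing_proj)
qed

text \<open>Both blocks of the Ricci curvature are instances of this trace, with the summands
  exchanged.\<close>

lemma trace_curvature:
  assumes D: "split_levi_civita br H V W D"
    and "a \<in> W" "b \<in> V"
  shows "trace_on V (\<lambda>w. curvature br H D w a b) =
    - trace_on V (\<lambda>w. p (B b (q (B a w)))) + divergence D (p (B a b))"
proof -
  obtain S where S: "finite S" "span S = V" using fin_left by blast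
  obtain T where T: "finite T" "span T = (UNIV :: 'a gtb set)" using finite_UNIV_span by blast
  note bil = split_levi_civitaD(2)[OF D] and invl = split_levi_civitaD(4)[OF D]
  have linl: "linear (\<lambda>u. D u x)" and linr: "linear (D x)" for x
    using bil unfolding bilinear_def by blast+
  note mixed = connection_mixed[OF D]
  \<comment> \<open>\<open>[w, a] = - D\<^sub>a w - pr\<^sub>W [a, w]\<close> turns the last curvature term into one that completes
    the trace of a commutator and one that gives the composition of the two \<open>\<Gamma>\<close> maps.\<close>
  have "curvature br H D w a b =
      (D w (D a b) - p (B b (q (B a w)))) - (D a (D w b) - D (D a w) b)" if "w \<in> V" for w
  proof -
    have "q (B w a) = - q (B a w)" "p (B w a) = - D a w"
      using dorfman_skew[OF br H, of w a] linear_neg[OF linear_coproj] linear_neg[OF linear_proj]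
        mixed[OF \<open>a \<in> W\<close> that] by auto
    then have Bwa: "B w a = - D a w - q (B a w)"
      using dorfman_proj_split[of w a] by simp
    \<comment> \<open>The mixed formula again, now with \<open>q (B a w)\<close> in
      \<open>W\<close>; reordering the bracket produces the sign.\<close>
    have "D (q (B a w)) b = - p (B b (q (B a w)))"
      using mixed[OF coproj_mem \<open>b \<in> V\<close>] dorfman_skew[OF br H] linear_neg[OF linear_proj]
      by metis
    then show ?thesis
      by (simp add: curvature_def Bwa bilinear_lsub[OF bil] bilinear_lneg[OF bil])
  qed
  then have "trace_on V (\<lambda>w. curvature br H D w a b) = trace_on V (\<lambda>w.
      (D w (D a b) - p (B b (q (B a w)))) - (D a (D w b) - D (D a w) b))"
    by (rule trace_on_cong[OF S])
  also have "\<dots> = (trace_on V (\<lambda>w. D w (D a b)) - trace_on V (\<lambda>w. p (B b (q (B a w))))) -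
      (trace_on V (\<lambda>w. D a (D w b)) - trace_on V (\<lambda>w. D (D a w) b))"
    using \<open>b \<in> V\<close> by (simp add: trace_on_diff[OF S] image_subset_iff invl
        real_vector.subspace_diff[OF subspace_left])
  \<comment> \<open>Cyclicity for the endomorphisms \<open>D a\<close> and
    \<open>\<lambda>w. D w b\<close> of \<open>V\<close>: their commutator has trace zero.\<close>
  also have "trace_on V (\<lambda>w. D a (D w b)) = trace_on V (\<lambda>w. D (D a w) b)"
    using trace_on_commute[OF S S linl[of b] linr[of a]] \<open>b \<in> V\<close>
    by (simp add: image_subset_iff invl o_def)
  \<comment> \<open>As \<open>D a b\<close> lies in \<open>V\<close>, the map takes values in
    \<open>V\<close>, so its trace over \<open>V\<close> is the full trace defining the
    divergence.\<close>
  also have "trace_on V (\<lambda>w. D w (D a b)) = divergence D (D a b)"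
    unfolding divergence_def
    by (rule trace_on_UNIV_eq[OF S T linl, symmetric]) (simp add: image_subset_iff invl \<open>b \<in> V\<close>)
  also have "D a b = p (B a b)"
    by (rule mixed) fact+
  finally show ?thesis by simp
qed

section \<open>Existence of a connection with prescribed divergence\<close>

text \<open>
  The mixed components are forced by \<open>connection_mixed\<close>; the factor \<open>1/3\<close> compensates for the three
  equal terms of the cyclic sum on each summand.
\<close>

definition base_connection :: "'a gtb \<Rightarrow> 'a gtb \<Rightarrow> 'a gtb" where
  "base_connection u v = p (B (q u) (p v)) + q (B (p u) (q v))
     + (1 / 3) *\<^sub>R p (B (p u) (p v)) + (1 / 3) *\<^sub>R q (B (q u) (q v))"

text \<open>
  On each summand \<open>\<langle>u,v\<rangle>e - \<langle>e,v\<rangle>u\<close> is skew for the pairing and has vanishing cyclic sum, so adding it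
  changes neither the torsion nor metricity, while its trace over \<open>u\<close> is \<open>(1 - n) \<langle>e,v\<rangle>\<close>.
\<close>

definition trace_correction :: "'a gtb \<Rightarrow> 'a gtb \<Rightarrow> 'a gtb \<Rightarrow> 'a gtb" where
  "trace_correction e u v =
     (pairing (p u) (p v) *\<^sub>R p e - pairing (p e) (p v) *\<^sub>R p u)
     + (pairing (q u) (q v) *\<^sub>R q e - pairing (q e) (q v) *\<^sub>R q u)"

lemmas split_linear_simps =
  linear_add[OF linear_proj] linear_cmul[OF linear_proj]
  linear_add[OF linear_coproj] linear_cmul[OF linear_coproj]
  bilinear_ladd[OF bilinear_dorfman[OF br H]] bilinear_radd[OF bilinear_dorfman[OF br H]]
  bilinear_lmul[OF bilinear_dorfman[OF br H]] bilinear_rmul[OF bilinear_dorfman[OF br H]]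

lemma bilinear_base_connection: "bilinear base_connection"
  by (simp add: bilinear_def linear_iff base_connection_def split_linear_simps scaleR_add_right
      scaleR_left_commute add_ac)

lemma bilinear_trace_correction: "bilinear (trace_correction e)"
  by (simp add: bilinear_def linear_iff trace_correction_def split_linear_simps pairing_simps
      scaleR_add_right scaleR_add_left scaleR_diff_right mult_ac algebra_simps)

text \<open>Self-adjointness moves the outer projections onto \<open>w\<close>, leaving the skew
  bracket form on components of \<open>u\<close>, \<open>v\<close>, \<open>w\<close>.\<close>

lemma pairing_base_connection:
  "pairing (base_connection u v) w = pairing (B (q u) (p v)) (p w) + pairing (B (p u) (q v)) (q w)
     + pairing (B (p u) (p v)) (p w) / 3 + pairing (B (q u) (q v)) (q w) / 3"
  by (simp add: base_connection_def pairing_simps pairing_proj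
      bracket_splitting.pairing_proj[OF swap])

lemma pairing_trace_correction:
  "pairing (trace_correction e u v) w =
     (pairing (p u) (p v) * pairing (p e) (p w) - pairing (p e) (p v) * pairing (p u) (p w))
     + (pairing (q u) (q v) * pairing (q e) (q w) - pairing (q e) (q v) * pairing (q u) (q w))"
  by (simp add: trace_correction_def pairing_simps pairing_proj_left[of _ w]
      bracket_splitting.pairing_proj_left[OF swap, of _ w])

text \<open>The first term has rank one; the second is a multiple of the projection
  \<open>p\<close>, whose trace is the dimension of \<open>V\<close>.\<close>

lemma trace_half_correction:
  "trace_on UNIV (\<lambda>u. pairing (p u) (p v) *\<^sub>R p e - pairing (p e) (p v) *\<^sub>R p u)
    = (1 - real DIM('a)) * pairing (p e) (p v)"
proof -
  obtain S where S: "finite S" "span S = V" using fin_left by blast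
  obtain T where T: "finite T" "span T = (UNIV :: 'a gtb set)" using finite_UNIV_span by blast
  have "linear (\<lambda>u. pairing (p u) (p v))"
    by (auto simp: linear_iff pairing_simps linear_add[OF linear_proj] linear_cmul[OF linear_proj])
  then have 1: "trace_on UNIV (\<lambda>u. pairing (p u) (p v) *\<^sub>R p e) = pairing (p e) (p v)"
    using trace_on_rank_one[OF T, of "\<lambda>u. pairing (p u) (p v)" "p e"] proj_id[OF proj_mem]
    by simp
  have "trace_on UNIV p = trace_on V p"
    by (rule trace_on_UNIV_eq[OF S T linear_proj]) auto
  also have "\<dots> = trace_on V (\<lambda>u. u)"
    by (rule trace_on_cong[OF S]) (rule proj_id)
  also have "\<dots> = DIM('a)" by (simp add: trace_on_ident[OF S] dim_left)
  finally have 2: "trace_on UNIV (\<lambda>u. pairing (p e) (p v) *\<^sub>R p u) =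
      pairing (p e) (p v) * DIM('a)"
    by (simp add: trace_on_scaleR[OF T])
  show ?thesis
    by (simp add: trace_on_diff[OF T] 1 2 algebra_simps)
qed

text \<open>The pairing splits orthogonally over the summands. Their equal dimensions give both
  halves the same factor.\<close>

lemma divergence_trace_correction:
  "divergence (trace_correction e) v = (1 - real DIM('a)) * pairing e v"
proof -
  obtain T where T: "finite T" "span T = (UNIV :: 'a gtb set)" using finite_UNIV_span by blast
  have "pairing e v = pairing (p e + q e) v" by (simp add: proj_add_coproj)
  then have "pairing e v = pairing (p e) (p v) + pairing (q e) (q v)"
    using pairing_proj_left[of e v] bracket_splitting.pairing_proj_left[OF swap, of e v]
    by (simp only: pairing_simps)
  then show ?thesis
    unfolding divergence_def trace_correction_def
    using trace_half_correction bracket_splitting.trace_half_correction[OF swap]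
    by (simp add: trace_on_add[OF T] distrib_left)
qed

lemma linear_divergence:
  assumes "bilinear D"
  shows "linear (divergence D :: 'a gtb \<Rightarrow> real)"
proof -
  obtain T where T: "finite T" "span T = (UNIV :: 'a gtb set)" using finite_UNIV_span by blast
  show ?thesis
    unfolding divergence_def
    by (rule linearI) (simp_all add: bilinear_radd[OF assms] bilinear_rmul[OF assms]
        trace_on_add[OF T] trace_on_scaleR[OF T])
qed

lemma gen_connection_base_correction:
  "gen_connection (\<lambda>u v. base_connection u v + trace_correction e u v)" (is "gen_connection ?D")
  unfolding gen_connection_def
proof (intro conjI allI)
  show "bilinear ?D"
    using bilinear_base_connection bilinear_trace_correction[of e]
    by (auto simp: bilinear_def intro!: linear_compose_add)
  fix u v w
  \<comment> \<open>Metricity of the base part is skewness of the bracket form in its last two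
    arguments, applied to each of the four components.\<close>
  have s: "pairing (B x z) y = - pairing (B x y) z" for x y z
    by (rule pairing_dorfman_skew(2)[OF br H])
  show "pairing (?D u v) w + pairing v (?D u w) = 0"
    unfolding pairing_commute[of v]
    by (simp add: pairing_simps pairing_base_connection pairing_trace_correction
        s[of "q u" "p w" "p v"] s[of "p u" "q w" "q v"] s[of "p u" "p w" "p v"]
        s[of "q u" "q w" "q v"])
qed

lemma torsion_base_correction:
  "torsion br H (\<lambda>u v. base_connection u v + trace_correction e u v) u v = 0"
proof (rule pairing_eqI)
  fix w
  have cyc: "pairing (B y z) x = pairing (B x y) z" for x y z
    using pairing_dorfman_skew[OF br H] by (metis add.inverse_inverse)
  have sum: "pairing (trace_correction e u v) w + pairing (trace_correction e v w) u
      + pairing (trace_correction e w u) v = 0"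
    unfolding pairing_trace_correction pairing_commute[of "p w"] pairing_commute[of "q w"]
      pairing_commute[of "p v" "p u"] pairing_commute[of "q v" "q u"] by algebra
  have "pairing (B u v) w = pairing (B (p u + q u) (p v + q v)) (p w + q w)"
    by (simp only: proj_add_coproj)
  \<comment> \<open>Of the eight components of the bracket form, each of the six mixed ones occurs
    once in the cyclic sum, and each of the two pure ones occurs three times with factor
    1/3.\<close>
  also have "\<dots> = pairing (base_connection u v) w + pairing (base_connection v w) u
      + pairing (base_connection w u) v"
    unfolding pairing_base_connection pairing_simps
      bilinear_ladd[OF bilinear_dorfman[OF br H]] bilinear_radd[OF bilinear_dorfman[OF br H]]
    using cyc[of "p u" "p v" "p w"] cyc[of "p w" "p u" "p v"]
      cyc[of "q u" "q v" "q w"] cyc[of "q w" "q u" "q v"]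
      cyc[of "p u" "q v" "p w"] cyc[of "p w" "p u" "q v"] cyc[of "q u" "p v" "q w"]
      cyc[of "q w" "q u" "p v"] cyc[of "p u" "p v" "q w"] cyc[of "q w" "p u" "p v"]
      cyc[of "q u" "q v" "p w"] cyc[of "p w" "q u" "q v"]
    by argo
  finally show "pairing (torsion br H (\<lambda>u v. base_connection u v + trace_correction e u v) u v) w
      = pairing 0 w"
    unfolding pairing_torsion[OF gen_connection_base_correction]
    using sum by (simp add: pairing_simps)
qed

text \<open>Every \<open>W\<close>-valued term contains \<open>q v\<close>, which vanishes for
  \<open>v\<close> in \<open>V\<close>.\<close>

lemma invariant_base_correction:
  assumes "v \<in> V"
  shows "base_connection u v + trace_correction e u v \<in> V"
proof -
  have "p v = v" "q v = 0"
    using proj_id[OF assms] by (simp_all add: coproj_eq)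
  then show ?thesis
    by (simp add: base_connection_def trace_correction_def pairing_simps
        bilinear_rzero[OF bilinear_dorfman[OF br H]] linear_0[OF linear_coproj]
        real_vector.subspace_add[OF subspace_left] real_vector.subspace_diff[OF subspace_left]
        real_vector.subspace_scale[OF subspace_left])
qed

lemma exists_connection_with_divergence:
  assumes "linear \<delta>" "DIM('a) \<ge> 2"
  obtains D where "split_levi_civita br H V W D" "divergence D = \<delta>"
proof -
  obtain T where T: "finite T" "span T = (UNIV :: 'a gtb set)" using finite_UNIV_span by blast
  \<comment> \<open>The inverse of the factor in the divergence of the correction; it is nonzero
    since the dimension is at least two.\<close>
  let ?c = "1 / (1 - real DIM('a))"
  have "linear (\<lambda>v. ?c *\<^sub>R (\<delta> v - divergence base_connection v))"
    by (intro linear_compose_scale_right linear_compose_sub assms(1)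
        linear_divergence bilinear_base_connection)
  \<comment> \<open>The missing divergence is a linear form, so the pairing represents its rescaling
    by some \<open>e\<close>.\<close>
  then obtain e where
    e: "\<And>v. ?c *\<^sub>R (\<delta> v - divergence base_connection v) = pairing e v"
    using pairing_representation by metis
  let ?D = "\<lambda>u v. base_connection u v + trace_correction e u v"
  have "divergence ?D v = divergence base_connection v + divergence (trace_correction e) v" for v
    unfolding divergence_def by (rule trace_on_add[OF T]) auto
  then have "divergence ?D v = \<delta> v" for v
    using assms(2) by (simp add: divergence_trace_correction e[symmetric])
  \<comment> \<open>Exchanging \<open>V\<close> and \<open>W\<close> only permutes the summands of
    \<open>?D\<close>.\<close>
  moreover have "?D u v \<in> W" if "v \<in> W" for u v
    using bracket_splitting.invariant_base_correction[OF swap that, of u e]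
    by (simp add: bracket_splitting.base_connection_def[OF swap] base_connection_def
        bracket_splitting.trace_correction_def[OF swap] trace_correction_def add_ac)
  moreover have "?D u v \<in> V" if "v \<in> V" for u v
    by (rule invariant_base_correction[OF that])
  ultimately show ?thesis
    using gen_connection_base_correction[of e] torsion_base_correction[of e]
    by (intro that[of ?D]) (auto simp only: split_levi_civita_def)
qed

end

section \<open>The splitting defined by the metric\<close>

lemma linear_flat:
  assumes "pseudo_metric g"
  shows "linear (flat g)"
proof -
  have "linear (\<lambda>X. g X Y)" for Y using assms by (simp add: pseudo_metric_def bilinear_def)
  then show ?thesis
    by (auto simp: linear_iff blinfun_apply_flat[OF assms] blinfun.add_left blinfun.scaleR_left
        intro!: blinfun_eqI)
qed

text \<open>The eigenspaces are graphs of \<open>flat g\<close> and its negative. The map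
  \<open>X\<close> to \<open>(X, f X)\<close> is linear and injective, so it carries
  \<open>Basis\<close> to a basis of the graph.\<close>

lemma
  fixes f :: "'a::euclidean_space \<Rightarrow> 'b::real_vector"
  assumes "linear f"
  shows subspace_graph: "subspace {(X, f X) | X. True}"
    and finite_span_graph: "\<exists>S. finite S \<and> span S = {(X, f X) | X. True}"
    and dim_graph: "dim {(X, f X) | X. True} = DIM('a)"
proof -
  let ?P = "\<lambda>X. (X, f X)"
  have eq: "{(X, f X) | X. True} = range ?P" by auto
  have lin: "linear ?P" using assms by (auto simp: linear_iff)
  have inj: "inj ?P" by (auto intro: injI)
  have sp: "span (?P ` Basis) = range ?P"
    by (simp add: linear_span_image[OF lin])
  have "independent (?P ` Basis)"
    using linear_independent_injective_image[OF lin independent_Basis] inj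
    by (simp add: inj_on_subset)
  then have "dim (range ?P) = card (?P ` Basis)"
    using real_vector.dim_span_eq_card_independent sp by metis
  then show "dim {(X, f X) | X. True} = DIM('a)"
    unfolding eq using inj by (simp add: card_image inj_on_subset)
  show "\<exists>S. finite S \<and> span S = {(X, f X) | X. True}"
    using sp eq by (metis finite_Basis finite_imageI)
  then show "subspace {(X, f X) | X. True}"
    by (metis real_vector.subspace_span)
qed

lemma bracket_splitting_E:
  assumes "pseudo_metric g" "lie_bracket br" "three_form H"
  shows "bracket_splitting (E_plus g) (E_minus g) br H"
proof
  note l = linear_flat[OF assms(1)]
  note m = linear_compose_neg[OF l]
  show "subspace (E_plus g)" "\<exists>S. finite S \<and> span S = E_plus g" "dim (E_plus g) = DIM('a)"
    unfolding E_plus_def by (rule subspace_graph[OF l] finite_span_graph[OF l] dim_graph[OF l])+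
  show "subspace (E_minus g)" "\<exists>S. finite S \<and> span S = E_minus g" "dim (E_minus g) = DIM('a)"
    unfolding E_minus_def by (rule subspace_graph[OF m] finite_span_graph[OF m] dim_graph[OF m])+
  show "\<exists>v\<in>E_plus g. u - v \<in> E_minus g" for u
  proof -
    obtain Z where Z: "flat g Z = snd u"
      using bij_is_surj[OF bij_flat[OF assms(1)]] by (metis surjD)
    \<comment> \<open>Solves \<open>X + Y = fst u\<close> and
      \<open>flat g X - flat g Y = snd u = flat g Z\<close> for the component
      \<open>X\<close>.\<close>
    let ?X = "(1 / 2) *\<^sub>R (fst u + Z)"
    have "fst u - ?X = (1 / 2) *\<^sub>R (fst u - Z)"
      by (simp add: algebra_simps flip: scaleR_add_left)
    moreover have "snd u - flat g ?X = - flat g ((1 / 2) *\<^sub>R (fst u - Z))"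
      unfolding linear_cmul[OF l] linear_add[OF l] linear_diff[OF l] Z
      by (simp add: algebra_simps flip: scaleR_add_left)
    ultimately have "u - (?X, flat g ?X) \<in> E_minus g"
      unfolding E_minus_def by (cases u) auto
    then show ?thesis unfolding E_plus_def by blast
  qed
  \<comment> \<open>The two contributions are \<open>g X Y\<close> and \<open>- g Y X\<close>, which
    cancel by symmetry.\<close>
  show "pairing v w = 0" if "v \<in> E_plus g" "w \<in> E_minus g" for v w
    using that assms(1)
    by (auto simp: E_plus_def E_minus_def pairing_def blinfun_apply_flat blinfun.minus_left)
      (simp add: pseudo_metric_def)
  show "lie_bracket br" "three_form H" by fact+
qed

section \<open>The Ricci curvature of the chosen connection\<close>

theorem theorem1p1:
  fixes br :: "'a::euclidean_space \<Rightarrow> 'a \<Rightarrow> 'a"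
    and g :: "'a \<Rightarrow> 'a \<Rightarrow> real"
    and H :: "'a \<Rightarrow> 'a \<Rightarrow> 'a \<Rightarrow> real"
    and \<delta> :: "'a gtb \<Rightarrow> real"
    and up um :: "'a gtb"
  assumes "DIM('a) \<ge> 2"
    and "lie_bracket br"
    and "pseudo_metric g"
    and "three_form H"
    and "closed_form br H"
    and "linear \<delta>"
    and "up \<in> E_plus g"
    and "um \<in> E_minus g"
  shows "gen_ricci br H g \<delta> um up =
           - trace_on (E_minus g) (Gamma_minus br H g um \<circ> Gamma_plus br H g up)
           + \<delta> (pr_plus g (dorfman br H um up)) \<and>
         gen_ricci br H g \<delta> up um =
           - trace_on (E_minus g) (Gamma_minus br H g um \<circ> Gamma_plus br H g up)
           + \<delta> (pr_minus g (dorfman br H up um))"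
proof -
  let ?B = "dorfman br H"
  interpret pm: bracket_splitting "E_plus g" "E_minus g" br H
    by (rule bracket_splitting_E) fact+
  interpret mp: bracket_splitting "E_minus g" "E_plus g" br H
    by (rule pm.swap)
  define D where "D = chosen_connection br H g \<delta>"
  \<comment> \<open>Existence is what gives the connection selected by \<open>SOME\<close> its
    properties.\<close>
  have "\<exists>D. levi_civita br H g D \<and> divergence D = \<delta>"
    using pm.exists_connection_with_divergence[OF assms(6,1)] levi_civita_iff_split by metis
  then have "levi_civita br H g D \<and> divergence D = \<delta>"
    unfolding D_def chosen_connection_def by (rule someI_ex)
  then have D: "split_levi_civita br H (E_plus g) (E_minus g) D" and div: "divergence D = \<delta>"
    using levi_civita_iff_split by blast+
  note bil = split_levi_civitaD(2)[OF D]
  \<comment> \<open>On mixed arguments one of the two blocks of \<open>gen_ricci\<close> is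
    evaluated at \<open>0 0\<close> and must drop out.\<close>
  have zero: "trace_on V (\<lambda>w. curvature br H D w 0 0) = 0" for V
    by (simp add: curvature_def bilinear_rzero[OF bil] trace_on_zero)
  have proj: "pr_plus g up = up" "pr_plus g um = 0" "pr_minus g um = um" "pr_minus g up = 0"
    using assms(7,8) by (simp_all add: pr_plus_def pr_minus_def pm.proj_id pm.proj_zero
        mp.proj_id mp.proj_zero)
  obtain S T where S: "finite S" "span S = E_plus g" and T: "finite T" "span T = E_minus g"
    using pm.fin_left pm.fin_right by blast
  have linB: "linear (?B u)" for u
    using bilinear_dorfman[OF assms(2,4)] unfolding bilinear_def by blast
  have linG: "linear (\<lambda>w. pr_plus g (?B u w))" "linear (\<lambda>w. pr_minus g (?B u w))" for u
    using linear_compose[OF linB pm.linear_proj] linear_compose[OF linB mp.linear_proj]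
    by (simp_all add: pr_plus_def pr_minus_def o_def)
  have mem: "pr_plus g u \<in> E_plus g" "pr_minus g u \<in> E_minus g" for u
    by (simp_all add: pr_plus_def pr_minus_def)
  \<comment> \<open>The restrictions in the \<open>Gamma\<close> maps are harmless:
    \<open>Gamma_plus\<close> is applied on \<open>E_minus g\<close> and takes values in
    \<open>E_plus g\<close>.\<close>
  have minus: "trace_on (E_minus g) (\<lambda>w. pr_minus g (?B um (pr_plus g (?B up w)))) =
      trace_on (E_minus g) (Gamma_minus br H g um \<circ> Gamma_plus br H g up)"
    by (rule trace_on_cong[OF T]) (simp add: Gamma_minus_def Gamma_plus_def mem)
  \<comment> \<open>Cyclicity moves the trace from \<open>E_plus g\<close> to
    \<open>E_minus g\<close>, so both formulas share one trace term.\<close>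
  have plus: "trace_on (E_plus g) (\<lambda>w. pr_plus g (?B up (pr_minus g (?B um w)))) =
      trace_on (E_minus g) (\<lambda>w. pr_minus g (?B um (pr_plus g (?B up w))))"
    using trace_on_commute[OF S T linG(2)[of um] linG(1)[of up]] by (simp add: o_def mem image_subset_iff)
  have "ric_plus br H g \<delta> um up =
      - trace_on (E_plus g) (\<lambda>w. pr_plus g (?B up (pr_minus g (?B um w)))) + \<delta> (pr_plus g (?B um up))"
    unfolding ric_plus_def D_def[symmetric] pr_plus_def pr_minus_def
    using pm.trace_curvature[OF D assms(8,7)] by (simp only: div)
  moreover have "ric_minus br H g \<delta> up um =
      - trace_on (E_minus g) (\<lambda>w. pr_minus g (?B um (pr_plus g (?B up w)))) + \<delta> (pr_minus g (?B up um))"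
    unfolding ric_minus_def D_def[symmetric] pr_plus_def pr_minus_def
    using mp.trace_curvature[OF split_levi_civita_swap[OF D] assms(7,8)] by (simp only: div)
  moreover have "ric_minus br H g \<delta> 0 0 = 0" "ric_plus br H g \<delta> 0 0 = 0"
    using zero by (simp_all add: ric_plus_def ric_minus_def D_def)
  ultimately show ?thesis
    by (simp add: gen_ricci_def proj plus minus)
qed

end
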